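(* Let $p$ be a prime, and let $(\mathcal M_\alpha)_{\alpha\ge0}=(\mathcal S_\alpha,\Sigma_p,\delta_\alpha,\overline s_\alpha,\mathbb Z/(p^\alpha\mathbb Z),\tau_\alpha)_{\alpha\ge0}$ be an inverse family of finite automata whose inverse limit is the profinite automaton $\mathcal M=(\mathcal S,\Sigma_p,\delta,\overline s,\mathbb Z_p,\tau)$. For each $\alpha\ge0$, let $\theta_\alpha$ be the substitution on $\mathcal S_\alpha$ corresponding to $\mathcal M_\alpha$, with fixed point $u_\alpha$. Let $u=\varprojlim u_\alpha\in\mathcal S^{\mathbb N}$. Then there is a length-$p$ substitution $\theta:\mathcal S\to\mathcal S^p$, with $\theta(u)=u$, such that for each $0\le\alpha\le\beta$ the diagram formed by the maps $\theta:X_u\to X_u$, $\theta_\beta:X_{u_\beta}\to X_{u_\beta}$, $\theta_\alpha:X_{u_\alpha}\to X_{u_\alpha}$, $\psi_{\beta,\infty}:X_u\to X_{u_\beta}$, $\psi_{\alpha,\infty}:X_u\to X_{u_\alpha}$ and $\psi_{\alpha,\beta}:X_{u_\beta}\to X_{u_\alpha}$ commutes, that is, $$\psi_{\alpha,\infty}=\psi_{\alpha,\beta}\circ\psi_{\beta,\infty},\quad \psi_{\alpha,\beta}\circ\theta_\beta=\theta_\alpha\circ\psi_{\alpha,\beta},\quad \psi_{\alpha,\infty}\circ\theta=\theta_\alpha\circ\psi_{\alpha,\infty},\quad \psi_{\beta,\infty}\circ\theta=\theta_\beta\circ\psi_{\beta,\infty}.$$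
   Context: $\Sigma_p=\{0,\dots,p-1\}$. A finite automaton here is a tuple $(\mathcal S,\Sigma_p,\delta,\overline s,\mathcal A,\tau)$ with finite state set $\mathcal S$, initial state $\overline s\in\mathcal S$, transition function $\delta:\mathcal S\times\Sigma_p\to\mathcal S$ (extended to words by $\delta(s,\epsilon)=s$, $\delta(s,n_\ell\cdots n_0)=\delta(\delta(s,n_\ell),n_{\ell-1}\cdots n_0)$), output alphabet $\mathcal A$ and output function $\tau:\mathcal S\to\mathcal A$. It generates the sequence $(\tau(\delta(\overline s,\mathrm{rep}_p(n))))_{n\ge0}$, where $\mathrm{rep}_p(n)$ is the standard base-$p$ representation of $n$, most significant digit first ($\mathrm{rep}_p(0)=\epsilon$). Let $\pi_{\alpha,\beta}:\mathbb Z/(p^\beta\mathbb Z)\to\mathbb Z/(p^\alpha\mathbb Z)$ and $\pi_{\alpha,\infty}:\mathbb Z_p\to\mathbb Z/(p^\alpha\mathbb Z)$ be the natural projections. $(\mathcal M_\alpha)_{\alpha\ge0}$ is an inverse family of finite automata if for all $0\le\alpha\le\beta$ there is a map $\psi_{\alpha,\beta}:\mathcal S_\beta\to\mathcal S_\alpha$ with $\psi_{\alpha,\beta}(\overline s_\beta)=\overline s_\alpha$, $\psi_{\alpha,\beta}(\delta_\beta(s,i))=\delta_\alpha(\psi_{\alpha,\beta}(s),i)$ and $\pi_{\alpha,\beta}(\tau_\beta(s))=\tau_\alpha(\psi_{\alpha,\beta}(s))$ for all $s\in\mathcal S_\beta$, $i\in\Sigma_p$, and $\psi_{\alpha,\gamma}=\psi_{\alpha,\beta}\circ\psi_{\beta,\gamma}$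 for $\alpha\le\beta\le\gamma$. Its inverse limit, a profinite automaton, is $(\mathcal S,\Sigma_p,\delta,\overline s,\mathbb Z_p,\tau)$ with $\mathcal S=\{(s_\alpha)_{\alpha}\in\prod_\alpha\mathcal S_\alpha:\psi_{\alpha,\beta}(s_\beta)=s_\alpha\text{ for all }\alpha\le\beta\}$, $\overline s=(\overline s_\alpha)_\alpha$, $(\delta(s,i))_\alpha=\delta_\alpha(s_\alpha,i)$, $\pi_{\alpha,\infty}(\tau(s))=\tau_\alpha(s_\alpha)$; the map $\psi_{\alpha,\infty}:\mathcal S\to\mathcal S_\alpha$ is $s\mapsto s_\alpha$. An element of $\mathcal S$ is written $s=\varprojlim s_\alpha$. A substitution on an alphabet $\mathcal A$ (not necessarily finite) is a map $\theta:\mathcal A\to\mathcal A^*$, extended to $\mathcal A^{\mathbb N}$ by concatenation; it has length $p$ if $|\theta(a)|=p$ for all $a\in\mathcal A$. A fixed point is a sequence $x\in\mathcal A^{\mathbb N}$ with $\theta(x)=x$. The substitution corresponding to a finite automaton $(\mathcal S,\Sigma_p,\delta,\overline s,\mathcal A,\tau)$ is $\theta(s)=\delta(s,0)\delta(s,1)\cdots\delta(s,p-1)$ for each state $s\in\mathcal S$; if $\delta(\overline s,0)\ne\overline s$, one introduces a new letter $\overline s'$ and lets $\theta(\overline s')=\overline s'\,\delta(\overline s,1)\cdots\delta(\overline s,p-1)$. The sequence $u_\alpha\in\mathcal S_\alpha^{\mathbb N}$ is the one generated by $(\mathcal S_\alpha,\Sigma_p,\delta_\alpha,\overline s_\alpha,\mathcal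 S_\alpha,\mathrm{id})$. The sequence $u=\varprojlim u_\alpha$ is identified with the element of $\mathcal S^{\mathbb N}$ whose $n$-th component is the inverse limit of the $n$-th components $u_\alpha(n)$. Finite alphabets are discrete, $\mathcal S$ has the inverse limit topology, and sequence spaces have the product topology; $\sigma$ is the shift $(x(n))_{n\ge 0}\mapsto(x(n+1))_{n\ge 0}$, and $X_x$ is the closure of $\{\sigma^n(x):n\in\mathbb N\}$. The maps $\psi_{\alpha,\beta}$ and $\psi_{\alpha,\infty}$ act termwise on sequences. *)

theory Defs
  imports "HOL-Analysis.Analysis" "HOL-Computational_Algebra.Primes"
begin

text \<open>Digits are natural numbers below \<open>p\<close>. All constraints on an automaton are relative to its
  set of states and to these digits; its functions are arbitrary elsewhere.\<close>

record ('s, 'o) automaton =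
  states :: "'s set"
  initial :: 's
  delta :: "'s \<Rightarrow> nat \<Rightarrow> 's"
  out :: "'s \<Rightarrow> 'o"

definition finite_automaton :: "nat \<Rightarrow> 'o set \<Rightarrow> ('s, 'o) automaton \<Rightarrow> bool" where
  "finite_automaton p A M \<longleftrightarrow>
     finite (states M) \<and> initial M \<in> states M \<and>
     (\<forall>s\<in>states M. \<forall>i<p. delta M s i \<in> states M) \<and> out M \<in> states M \<rightarrow> A"

text \<open>Base-\<open>p\<close> representation, most significant digit first; the guard \<open>p < 2\<close> only serves termination.\<close>

fun rep :: "nat \<Rightarrow> nat \<Rightarrow> nat list" where
  "rep p n = (if n = 0 \<or> p < 2 then [] else rep p (n div p) @ [n mod p])"

declare rep.simps [simp del]

definition generated :: "nat \<Rightarrow> ('s, 'o) automaton \<Rightarrow> nat \<Rightarrow> 'o" where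
  "generated p M n = out M (foldl (delta M) (initial M) (rep p n))"

definition state_automaton :: "('s, 'o) automaton \<Rightarrow> ('s, 's) automaton" where
  "state_automaton M =
     \<lparr>states = states M, initial = initial M, delta = delta M, out = (\<lambda>s. s)\<rparr>"

text \<open>The ring of integers modulo \<open>p ^ \<alpha>\<close> is represented by its residues \<open>{0..<p ^ \<alpha>}\<close>, and the
  projection to a smaller exponent by reduction with \<open>mod\<close>.\<close>

definition inverse_family ::
  "nat \<Rightarrow> (nat \<Rightarrow> ('s, int) automaton) \<Rightarrow> (nat \<Rightarrow> nat \<Rightarrow> 's \<Rightarrow> 's) \<Rightarrow> bool" where
  "inverse_family p M \<psi> \<longleftrightarrow>
     (\<forall>\<alpha>. finite_automaton p {0..<int p ^ \<alpha>} (M \<alpha>)) \<and>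
     (\<forall>\<alpha> \<beta>. \<alpha> \<le> \<beta> \<longrightarrow>
        \<psi> \<alpha> \<beta> \<in> states (M \<beta>) \<rightarrow> states (M \<alpha>) \<and>
        \<psi> \<alpha> \<beta> (initial (M \<beta>)) = initial (M \<alpha>) \<and>
        (\<forall>s\<in>states (M \<beta>). \<forall>i<p. \<psi> \<alpha> \<beta> (delta (M \<beta>) s i) = delta (M \<alpha>) (\<psi> \<alpha> \<beta> s) i) \<and>
        (\<forall>s\<in>states (M \<beta>). out (M \<beta>) s mod int p ^ \<alpha> = out (M \<alpha>) (\<psi> \<alpha> \<beta> s))) \<and>
     (\<forall>\<alpha> \<beta> \<gamma>. \<alpha> \<le> \<beta> \<longrightarrow> \<beta> \<le> \<gamma> \<longrightarrow>
        (\<forall>s\<in>states (M \<gamma>). \<psi> \<alpha> \<gamma> s = \<psi> \<alpha> \<beta> (\<psi> \<beta> \<gamma> s)))"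

lemma inverse_familyD:
  assumes "inverse_family p M \<psi>"
  shows "finite (states (M \<alpha>))" "initial (M \<alpha>) \<in> states (M \<alpha>)"
    and "\<And>s i. s \<in> states (M \<alpha>) \<Longrightarrow> i < p \<Longrightarrow> delta (M \<alpha>) s i \<in> states (M \<alpha>)"
    and "\<And>s. s \<in> states (M \<alpha>) \<Longrightarrow> out (M \<alpha>) s \<in> {0..<int p ^ \<alpha>}"
    and "\<And>\<beta> s. \<alpha> \<le> \<beta> \<Longrightarrow> s \<in> states (M \<beta>) \<Longrightarrow> \<psi> \<alpha> \<beta> s \<in> states (M \<alpha>)"
    and "\<And>\<beta>. \<alpha> \<le> \<beta> \<Longrightarrow> \<psi> \<alpha> \<beta> (initial (M \<beta>)) = initial (M \<alpha>)"
    and "\<And>\<beta> s i. \<alpha> \<le> \<beta> \<Longrightarrow> s \<in> states (M \<beta>) \<Longrightarrow> i < p \<Longrightarrow>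
           \<psi> \<alpha> \<beta> (delta (M \<beta>) s i) = delta (M \<alpha>) (\<psi> \<alpha> \<beta> s) i"
    and "\<And>\<beta> s. \<alpha> \<le> \<beta> \<Longrightarrow> s \<in> states (M \<beta>) \<Longrightarrow>
           out (M \<beta>) s mod int p ^ \<alpha> = out (M \<alpha>) (\<psi> \<alpha> \<beta> s)"
    and "\<And>\<beta> \<gamma> s. \<alpha> \<le> \<beta> \<Longrightarrow> \<beta> \<le> \<gamma> \<Longrightarrow> s \<in> states (M \<gamma>) \<Longrightarrow>
           \<psi> \<alpha> \<gamma> s = \<psi> \<alpha> \<beta> (\<psi> \<beta> \<gamma> s)"
proof -
  note f = assms[unfolded inverse_family_def]
  note f1 = conjunct1[OF f, THEN spec, of \<alpha>, unfolded finite_automaton_def]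
    and f2 = conjunct1[OF conjunct2[OF f], THEN spec, of \<alpha>]
    and f3 = conjunct2[OF conjunct2[OF f], THEN spec, of \<alpha>]
  show "finite (states (M \<alpha>))" "initial (M \<alpha>) \<in> states (M \<alpha>)"
    "\<And>s i. s \<in> states (M \<alpha>) \<Longrightarrow> i < p \<Longrightarrow> delta (M \<alpha>) s i \<in> states (M \<alpha>)"
    "\<And>s. s \<in> states (M \<alpha>) \<Longrightarrow> out (M \<alpha>) s \<in> {0..<int p ^ \<alpha>}"
    using f1 by (blast dest: Pi_mem)+
  show "\<And>\<beta> s. \<alpha> \<le> \<beta> \<Longrightarrow> s \<in> states (M \<beta>) \<Longrightarrow> \<psi> \<alpha> \<beta> s \<in> states (M \<alpha>)"
    "\<And>\<beta>. \<alpha> \<le> \<beta> \<Longrightarrow> \<psi> \<alpha> \<beta> (initial (M \<beta>)) = initial (M \<alpha>)"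
    "\<And>\<beta> s i. \<alpha> \<le> \<beta> \<Longrightarrow> s \<in> states (M \<beta>) \<Longrightarrow> i < p \<Longrightarrow>
       \<psi> \<alpha> \<beta> (delta (M \<beta>) s i) = delta (M \<alpha>) (\<psi> \<alpha> \<beta> s) i"
    "\<And>\<beta> s. \<alpha> \<le> \<beta> \<Longrightarrow> s \<in> states (M \<beta>) \<Longrightarrow>
       out (M \<beta>) s mod int p ^ \<alpha> = out (M \<alpha>) (\<psi> \<alpha> \<beta> s)"
    using f2 by (simp_all add: Pi_iff)
  show "\<And>\<beta> \<gamma> s. \<alpha> \<le> \<beta> \<Longrightarrow> \<beta> \<le> \<gamma> \<Longrightarrow> s \<in> states (M \<gamma>) \<Longrightarrow>
      \<psi> \<alpha> \<gamma> s = \<psi> \<alpha> \<beta> (\<psi> \<beta> \<gamma> s)"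
    by (rule f3[rule_format])
qed

text \<open>A \<open>p\<close>-adic integer is represented by the sequence of its residues modulo the powers of \<open>p\<close>.\<close>

definition padic_ints :: "nat \<Rightarrow> (nat \<Rightarrow> int) set" where
  "padic_ints p = {x. (\<forall>\<alpha>. x \<alpha> \<in> {0..<int p ^ \<alpha>}) \<and> (\<forall>\<alpha> \<beta>. \<alpha> \<le> \<beta> \<longrightarrow> x \<beta> mod int p ^ \<alpha> = x \<alpha>)}"

definition inverse_limit ::
  "(nat \<Rightarrow> ('s, int) automaton) \<Rightarrow> (nat \<Rightarrow> nat \<Rightarrow> 's \<Rightarrow> 's) \<Rightarrow> (nat \<Rightarrow> 's, nat \<Rightarrow> int) automaton" where
  "inverse_limit M \<psi> =
     \<lparr>states = {s. (\<forall>\<alpha>. s \<alpha> \<in> states (M \<alpha>)) \<and> (\<forall>\<alpha> \<beta>. \<alpha> \<le> \<beta> \<longrightarrow> \<psi> \<alpha> \<beta> (s \<beta>) = s \<alpha>)},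
      initial = (\<lambda>\<alpha>. initial (M \<alpha>)),
      delta = (\<lambda>s i \<alpha>. delta (M \<alpha>) (s \<alpha>) i),
      out = (\<lambda>s \<alpha>. out (M \<alpha>) (s \<alpha>))\<rparr>"

lemma out_inverse_limit:
  assumes "inverse_family p M \<psi>"
  shows "out (inverse_limit M \<psi>) \<in> states (inverse_limit M \<psi>) \<rightarrow> padic_ints p"
proof
  fix s assume "s \<in> states (inverse_limit M \<psi>)"
  then have s: "s \<alpha> \<in> states (M \<alpha>)" "\<alpha> \<le> \<beta> \<Longrightarrow> \<psi> \<alpha> \<beta> (s \<beta>) = s \<alpha>" for \<alpha> \<beta>
    by (auto simp: inverse_limit_def)
  show "out (inverse_limit M \<psi>) s \<in> padic_ints p"
    using inverse_familyD(4,8)[OF assms] s by (simp add: inverse_limit_def padic_ints_def)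
qed

definition inverse_limit_topology ::
  "(nat \<Rightarrow> ('s, int) automaton) \<Rightarrow> (nat \<Rightarrow> nat \<Rightarrow> 's \<Rightarrow> 's) \<Rightarrow> (nat \<Rightarrow> 's) topology" where
  "inverse_limit_topology M \<psi> =
     subtopology (product_topology (\<lambda>\<alpha>. discrete_topology (states (M \<alpha>))) UNIV)
       (states (inverse_limit M \<psi>))"

text \<open>If \<open>0\<close> does not fix the initial state, the letter \<open>c\<close> (which has to be new) is added as an
  initial state that \<open>0\<close> fixes and that otherwise behaves like the old initial state. The
  substitution corresponding to \<open>M\<close>, including its extra letter if there is one, is thus
  \<open>substitution p (loop_completion c M)\<close>.\<close>

definition loop_completion :: "'s \<Rightarrow> ('s, 'o) automaton \<Rightarrow> ('s, 'o) automaton" where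
  "loop_completion c M =
     (if delta M (initial M) 0 = initial M then M
      else \<lparr>states = insert c (states M), initial = c,
            delta = (delta M)(c := (\<lambda>i. if i = 0 then c else delta M (initial M) i)),
            out = (out M)(c := out M (initial M))\<rparr>)"

definition substitution :: "nat \<Rightarrow> ('s, 'o) automaton \<Rightarrow> 's \<Rightarrow> 's list" where
  "substitution p M s = map (delta M s) [0..<p]"

text \<open>The extra letters are mapped to each other, or to the initial state where no extra letter is
  needed. At an exponent \<open>\<beta>\<close> without extra letter this update does not change \<open>\<psi> \<alpha> \<beta>\<close>.\<close>

definition completed_map ::
  "(nat \<Rightarrow> 's) \<Rightarrow> (nat \<Rightarrow> ('s, 'o) automaton) \<Rightarrow> (nat \<Rightarrow> nat \<Rightarrow> 's \<Rightarrow> 's) \<Rightarrow> nat \<Rightarrow> nat \<Rightarrow> 's \<Rightarrow> 's" where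
  "completed_map c M \<psi> \<alpha> \<beta> =
     (\<psi> \<alpha> \<beta>)(initial (loop_completion (c \<beta>) (M \<beta>)) := initial (loop_completion (c \<alpha>) (M \<alpha>)))"

lemma loop_completion_trivial:
  assumes "inverse_family p M \<psi>" "\<And>\<alpha>. delta (M \<alpha>) (initial (M \<alpha>)) 0 = initial (M \<alpha>)" "\<alpha> \<le> \<beta>"
  shows "loop_completion (c \<alpha>) (M \<alpha>) = M \<alpha>" "completed_map c M \<psi> \<alpha> \<beta> = \<psi> \<alpha> \<beta>"
  using assms(2) inverse_familyD(6)[OF assms(1,3)]
  by (auto simp: loop_completion_def completed_map_def)

lemma completed_map_old:
  assumes "inverse_family p M \<psi>" "\<alpha> \<le> \<beta>" "s \<in> states (M \<beta>)"
    and "delta (M \<beta>) (initial (M \<beta>)) 0 \<noteq> initial (M \<beta>) \<Longrightarrow> c \<beta> \<notin> states (M \<beta>)"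
    and "p > 0"
  shows "completed_map c M \<psi> \<alpha> \<beta> s = \<psi> \<alpha> \<beta> s"
proof (cases "delta (M \<beta>) (initial (M \<beta>)) 0 = initial (M \<beta>)")
  case True
  note init = inverse_familyD(2)[OF assms(1), of \<beta>] inverse_familyD(6)[OF assms(1,2)]
  have "delta (M \<alpha>) (initial (M \<alpha>)) 0 = initial (M \<alpha>)"
    using inverse_familyD(7)[OF assms(1,2) init(1) assms(5)] init(2) True by simp
  then show ?thesis using True init(2) by (simp add: completed_map_def loop_completion_def)
next
  case False
  then show ?thesis using assms(3,4) by (auto simp: completed_map_def loop_completion_def)
qed

lemma inverse_family_completion:
  assumes fam: "inverse_family p M \<psi>" and p: "p > 0"
    and new: "\<And>\<alpha>. delta (M \<alpha>) (initial (M \<alpha>)) 0 \<noteq> initial (M \<alpha>) \<Longrightarrow> c \<alpha> \<notin> states (M \<alpha>)"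
  shows "inverse_family p (\<lambda>\<alpha>. loop_completion (c \<alpha>) (M \<alpha>)) (completed_map c M \<psi>)"
proof -
  let ?N = "\<lambda>\<alpha>. loop_completion (c \<alpha>) (M \<alpha>)" and ?P = "completed_map c M \<psi>"
  have old: "?P \<alpha> \<beta> s = \<psi> \<alpha> \<beta> s" if "\<alpha> \<le> \<beta>" "s \<in> states (M \<beta>)" for \<alpha> \<beta> s
    using completed_map_old[OF fam that _ p] new by blast
  have ini: "?P \<alpha> \<beta> (initial (?N \<beta>)) = initial (?N \<alpha>)" for \<alpha> \<beta>
    by (simp add: completed_map_def)
  have fin: "finite (states (M \<alpha>))" "initial (M \<alpha>) \<in> states (M \<alpha>)"
    "s \<in> states (M \<alpha>) \<Longrightarrow> i < p \<Longrightarrow> delta (M \<alpha>) s i \<in> states (M \<alpha>)"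
    "s \<in> states (M \<alpha>) \<Longrightarrow> out (M \<alpha>) s \<in> {0..<int p ^ \<alpha>}" for \<alpha> s i
    using inverse_familyD(1-4)[OF fam] by blast+
  have hom: "s \<in> states (M \<beta>) \<Longrightarrow> \<psi> \<alpha> \<beta> s \<in> states (M \<alpha>)"
    "\<psi> \<alpha> \<beta> (initial (M \<beta>)) = initial (M \<alpha>)"
    "s \<in> states (M \<beta>) \<Longrightarrow> i < p \<Longrightarrow> \<psi> \<alpha> \<beta> (delta (M \<beta>) s i) = delta (M \<alpha>) (\<psi> \<alpha> \<beta> s) i"
    "s \<in> states (M \<beta>) \<Longrightarrow> out (M \<beta>) s mod int p ^ \<alpha> = out (M \<alpha>) (\<psi> \<alpha> \<beta> s)"
    if "\<alpha> \<le> \<beta>" for \<alpha> \<beta> s i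
    using inverse_familyD(5-8)[OF fam that] by blast+
  have comp: "\<psi> \<alpha> \<gamma> s = \<psi> \<alpha> \<beta> (\<psi> \<beta> \<gamma> s)"
    if "\<alpha> \<le> \<beta>" "\<beta> \<le> \<gamma>" "s \<in> states (M \<gamma>)" for \<alpha> \<beta> \<gamma> s
    by (rule inverse_familyD(9)[OF fam that])
  have sub: "s \<in> states (M \<alpha>) \<Longrightarrow> s \<in> states (?N \<alpha>)" for \<alpha> s
    by (auto simp: loop_completion_def)
  have N_ini: "initial (?N \<alpha>) \<in> states (?N \<alpha>)" for \<alpha>
    using fin(2) by (auto simp: loop_completion_def)
  have N_cases: "s = initial (?N \<alpha>) \<or> s \<in> states (M \<alpha>)" if "s \<in> states (?N \<alpha>)" for \<alpha> s
    using that by (auto simp: loop_completion_def split: if_splits)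
  have N_old: "delta (?N \<alpha>) s i = delta (M \<alpha>) s i" "out (?N \<alpha>) s = out (M \<alpha>) s"
    if "s \<in> states (M \<alpha>)" for \<alpha> s i
    using new[of \<alpha>] that by (auto simp: loop_completion_def)
  have N_start: "delta (?N \<alpha>) (initial (?N \<alpha>)) i =
      (if i = 0 then initial (?N \<alpha>) else delta (M \<alpha>) (initial (M \<alpha>)) i)"
    "out (?N \<alpha>) (initial (?N \<alpha>)) = out (M \<alpha>) (initial (M \<alpha>))" for \<alpha> i
    by (auto simp: loop_completion_def)
  have "finite_automaton p {0..<int p ^ \<alpha>} (?N \<alpha>)" for \<alpha>
  proof -
    have "finite (states (?N \<alpha>))" using fin(1) by (simp add: loop_completion_def)
    moreover have "delta (?N \<alpha>) s i \<in> states (?N \<alpha>)" "out (?N \<alpha>) s \<in> {0..<int p ^ \<alpha>}"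
      if "s \<in> states (?N \<alpha>)" "i < p" for s i
      using N_cases[OF that(1)]
    proof (atomize (full), elim disjE)
      assume s: "s = initial (?N \<alpha>)"
      show "delta (?N \<alpha>) s i \<in> states (?N \<alpha>) \<and> out (?N \<alpha>) s \<in> {0..<int p ^ \<alpha>}"
        unfolding s N_start using N_ini[of \<alpha>] sub[OF fin(3)[OF fin(2) that(2)]] fin(4)[OF fin(2)]
        by simp
    next
      assume s: "s \<in> states (M \<alpha>)"
      show "delta (?N \<alpha>) s i \<in> states (?N \<alpha>) \<and> out (?N \<alpha>) s \<in> {0..<int p ^ \<alpha>}"
        unfolding N_old[OF s] using sub[OF fin(3)[OF s that(2)]] fin(4)[OF s] by blast
    qed
    ultimately show ?thesis using N_ini p unfolding finite_automaton_def by blast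
  qed
  moreover have "?P \<alpha> \<beta> \<in> states (?N \<beta>) \<rightarrow> states (?N \<alpha>)" if "\<alpha> \<le> \<beta>" for \<alpha> \<beta>
  proof
    fix s assume "s \<in> states (?N \<beta>)"
    from N_cases[OF this] show "?P \<alpha> \<beta> s \<in> states (?N \<alpha>)"
    proof
      assume "s = initial (?N \<beta>)"
      then show ?thesis using ini[of \<alpha> \<beta>] N_ini[of \<alpha>] by simp
    next
      assume s: "s \<in> states (M \<beta>)"
      show ?thesis unfolding old[OF that s] by (rule sub[OF hom(1)[OF that s]])
    qed
  qed
  moreover have "?P \<alpha> \<beta> (delta (?N \<beta>) s i) = delta (?N \<alpha>) (?P \<alpha> \<beta> s) i"
    if "\<alpha> \<le> \<beta>" "s \<in> states (?N \<beta>)" "i < p" for \<alpha> \<beta> s i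
    using N_cases[OF that(2)]
  proof
    assume "s = initial (?N \<beta>)"
    then show ?thesis
      using ini[of \<alpha> \<beta>] N_start(1) old[OF that(1) fin(3)[OF fin(2) that(3)]]
        hom(3)[OF that(1) fin(2) that(3)] hom(2)[OF that(1)]
      by (cases "i = 0") simp_all
  next
    assume s: "s \<in> states (M \<beta>)"
    show ?thesis
      unfolding N_old(1)[OF s] old[OF that(1) s] old[OF that(1) fin(3)[OF s that(3)]]
        N_old(1)[OF hom(1)[OF that(1) s]]
      by (rule hom(3)[OF that(1) s that(3)])
  qed
  moreover have "out (?N \<beta>) s mod int p ^ \<alpha> = out (?N \<alpha>) (?P \<alpha> \<beta> s)"
    if "\<alpha> \<le> \<beta>" "s \<in> states (?N \<beta>)" for \<alpha> \<beta> s
    using N_cases[OF that(2)]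
  proof
    assume s: "s = initial (?N \<beta>)"
    show ?thesis
      unfolding s ini N_start(2) using hom(4)[OF that(1) fin(2)] hom(2)[OF that(1)] by simp
  next
    assume s: "s \<in> states (M \<beta>)"
    show ?thesis
      unfolding N_old(2)[OF s] old[OF that(1) s] N_old(2)[OF hom(1)[OF that(1) s]]
      by (rule hom(4)[OF that(1) s])
  qed
  moreover have "?P \<alpha> \<gamma> s = ?P \<alpha> \<beta> (?P \<beta> \<gamma> s)"
    if "\<alpha> \<le> \<beta>" "\<beta> \<le> \<gamma>" "s \<in> states (?N \<gamma>)" for \<alpha> \<beta> \<gamma> s
    using N_cases[OF that(3)]
  proof
    assume s: "s = initial (?N \<gamma>)"
    show ?thesis unfolding s ini ..
  next
    assume s: "s \<in> states (M \<gamma>)"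
    show ?thesis
      unfolding old[OF le_trans[OF that(1,2)] s] old[OF that(2) s]
        old[OF that(1) hom(1)[OF that(2) s]]
      by (rule comp[OF that(1,2) s])
  qed
  ultimately show ?thesis
    using ini unfolding inverse_family_def by (intro conjI allI impI ballI) simp_all
qed

text \<open>Completing a family level by level amounts to completing its inverse limit.\<close>

lemma states_inverse_limit_completion:
  assumes fam: "inverse_family p M \<psi>" and p: "p > 0"
    and new: "\<And>\<alpha>. delta (M \<alpha>) (initial (M \<alpha>)) 0 \<noteq> initial (M \<alpha>) \<Longrightarrow> c \<alpha> \<notin> states (M \<alpha>)"
  shows "states (inverse_limit (\<lambda>\<alpha>. loop_completion (c \<alpha>) (M \<alpha>)) (completed_map c M \<psi>)) =
    states (loop_completion (\<lambda>\<alpha>. initial (loop_completion (c \<alpha>) (M \<alpha>))) (inverse_limit M \<psi>))"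
    (is "?L = ?R")
proof -
  let ?N = "\<lambda>\<alpha>. loop_completion (c \<alpha>) (M \<alpha>)" and ?P = "completed_map c M \<psi>"
  let ?S = "states (inverse_limit M \<psi>)"
  define start where "start = (\<lambda>\<alpha>. initial (?N \<alpha>))"
  define triv where "triv \<alpha> \<longleftrightarrow> delta (M \<alpha>) (initial (M \<alpha>)) 0 = initial (M \<alpha>)" for \<alpha>
  have old: "?P \<alpha> \<beta> s = \<psi> \<alpha> \<beta> s" if "\<alpha> \<le> \<beta>" "s \<in> states (M \<beta>)" for \<alpha> \<beta> s
    using completed_map_old[OF fam that _ p] new by blast
  have ini: "?P \<alpha> \<beta> (start \<beta>) = start \<alpha>" for \<alpha> \<beta>
    by (simp add: completed_map_def start_def)
  have fin: "initial (M \<alpha>) \<in> states (M \<alpha>)" for \<alpha>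
    by (rule inverse_familyD(2)[OF fam])
  have hom: "s \<in> states (M \<beta>) \<Longrightarrow> \<psi> \<alpha> \<beta> s \<in> states (M \<alpha>)"
    "\<psi> \<alpha> \<beta> (initial (M \<beta>)) = initial (M \<alpha>)" if "\<alpha> \<le> \<beta>" for \<alpha> \<beta> s
    using inverse_familyD(5,6)[OF fam that] by blast+
  have N_triv: "states (?N \<alpha>) = states (M \<alpha>)" "start \<alpha> = initial (M \<alpha>)" if "triv \<alpha>" for \<alpha>
    using that by (auto simp: loop_completion_def triv_def start_def)
  have N_nontriv: "states (?N \<alpha>) = insert (start \<alpha>) (states (M \<alpha>))" "start \<alpha> \<notin> states (M \<alpha>)"
    if "\<not> triv \<alpha>" for \<alpha>
    using that new by (auto simp: loop_completion_def triv_def start_def)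
  have start_in: "start \<alpha> \<in> states (?N \<alpha>)" for \<alpha>
    using N_triv N_nontriv fin by (cases "triv \<alpha>") auto
  have S: "s \<in> ?S \<longleftrightarrow> (\<forall>\<alpha>. s \<alpha> \<in> states (M \<alpha>)) \<and> (\<forall>\<alpha> \<beta>. \<alpha> \<le> \<beta> \<longrightarrow> \<psi> \<alpha> \<beta> (s \<beta>) = s \<alpha>)" for s
    by (simp add: inverse_limit_def)
  have L: "s \<in> ?L \<longleftrightarrow> (\<forall>\<alpha>. s \<alpha> \<in> states (?N \<alpha>)) \<and> (\<forall>\<alpha> \<beta>. \<alpha> \<le> \<beta> \<longrightarrow> ?P \<alpha> \<beta> (s \<beta>) = s \<alpha>)" for s
    by (simp add: inverse_limit_def)
  have sub: "s \<in> ?L" if "s \<in> ?S" for s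
  proof -
    have "s \<alpha> \<in> states (?N \<alpha>)" for \<alpha>
      using that N_triv(1) N_nontriv(1) unfolding S by (cases "triv \<alpha>") auto
    then show ?thesis using that old unfolding S L by metis
  qed
  have "start \<in> ?L" using start_in ini unfolding L by simp
  moreover have "s \<in> ?S \<or> s = start" if s: "s \<in> ?L" for s
  proof (cases "\<forall>\<alpha>. s \<alpha> \<in> states (M \<alpha>)")
    case True
    then show ?thesis using s old unfolding S L by metis
  next
    case False
    then obtain \<beta> where \<beta>: "s \<beta> \<notin> states (M \<beta>)" by blast
    have "s \<gamma> = start \<gamma>" if "\<beta> \<le> \<gamma>" for \<gamma>
    proof -
      have "s \<gamma> \<notin> states (M \<gamma>)" using \<beta> s old[OF that] hom(1)[OF that] that unfolding L by metis
      then show ?thesis using s N_triv(1) N_nontriv(1) unfolding L by (metis insertE)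
    qed
    then have "s \<alpha> = start \<alpha>" for \<alpha>
    proof -
      have "?P \<alpha> (max \<alpha> \<beta>) (s (max \<alpha> \<beta>)) = s \<alpha>" using s unfolding L by simp
      moreover have "s (max \<alpha> \<beta>) = start (max \<alpha> \<beta>)"
        by (rule \<open>\<And>\<gamma>. \<beta> \<le> \<gamma> \<Longrightarrow> s \<gamma> = start \<gamma>\<close>) simp
      ultimately show ?thesis using ini[of \<alpha> "max \<alpha> \<beta>"] by simp
    qed
    then show ?thesis by blast
  qed
  moreover have "?R = (if \<forall>\<alpha>. triv \<alpha> then ?S else insert start ?S)"
    by (auto simp: loop_completion_def inverse_limit_def start_def triv_def fun_eq_iff)
  moreover have "start \<in> ?S" if "\<forall>\<alpha>. triv \<alpha>"
    using that N_triv(2) fin hom(2) unfolding S by simp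
  ultimately show ?thesis using sub by (auto split: if_splits)
qed

definition uniform_substitution :: "nat \<Rightarrow> 'a set \<Rightarrow> ('a \<Rightarrow> 'a list) \<Rightarrow> bool" where
  "uniform_substitution p A \<theta> \<longleftrightarrow> (\<forall>a\<in>A. length (\<theta> a) = p \<and> set (\<theta> a) \<subseteq> A)"

text \<open>Extension of a substitution to sequences by concatenation. Since \<open>\<theta>\<close> is applied only when it
  has no empty values, the images of the first \<open>n + 1\<close> letters determine the letter at \<open>n\<close>.\<close>

definition subst_seq :: "('a \<Rightarrow> 'a list) \<Rightarrow> (nat \<Rightarrow> 'a) \<Rightarrow> nat \<Rightarrow> 'a" where
  "subst_seq \<theta> x n = concat (map (\<lambda>k. \<theta> (x k)) [0..<Suc n]) ! n"

lemma subst_seq_uniform: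
  assumes "p > 0" "\<And>k. length (\<theta> (x k)) = p"
  shows "subst_seq \<theta> x n = \<theta> (x (n div p)) ! (n mod p)"
proof -
  have len: "length (concat (map (\<lambda>k. \<theta> (x k)) [0..<m])) = m * p" for m
    by (induction m) (simp_all add: assms(2))
  have "concat (map (\<lambda>k. \<theta> (x k)) [0..<m]) ! n = \<theta> (x (n div p)) ! (n mod p)"
    if "n < m * p" for m
    using that
  proof (induction m)
    case (Suc m)
    show ?case
    proof (cases "n < m * p")
      case True
      then show ?thesis using Suc.IH by (simp add: nth_append len)
    next
      case False
      then obtain j where j: "n = j + m * p" "j < p"
        using Suc.prems by (metis add.commute add_less_cancel_left le_Suc_ex mult_Suc not_less)
      then have "n div p = m" "n mod p = n - m * p"
        using assms(1) by simp_all
      then show ?thesis using False by (simp add: nth_append len)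
    qed
  qed simp
  moreover have "n < Suc n * p"
    using assms(1) by (cases p) simp_all
  ultimately show ?thesis unfolding subst_seq_def by blast
qed

definition shift :: "(nat \<Rightarrow> 'a) \<Rightarrow> nat \<Rightarrow> 'a" where
  "shift x = (\<lambda>n. x (Suc n))"

definition orbit_closure :: "'a topology \<Rightarrow> (nat \<Rightarrow> 'a) \<Rightarrow> (nat \<Rightarrow> 'a) set" where
  "orbit_closure T x = (product_topology (\<lambda>_. T) UNIV) closure_of (range (\<lambda>k. (shift ^^ k) x))"

text \<open>Termwise action of a map on letters; the projection of the inverse limit to exponent \<open>\<alpha>\<close> is
  evaluation at \<open>\<alpha>\<close>.\<close>

definition termwise :: "('a \<Rightarrow> 'b) \<Rightarrow> (nat \<Rightarrow> 'a) \<Rightarrow> nat \<Rightarrow> 'b" where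
  "termwise f x = (\<lambda>n. f (x n))"

definition limit_proj :: "nat \<Rightarrow> (nat \<Rightarrow> 's) \<Rightarrow> 's" where
  "limit_proj \<alpha> s = s \<alpha>"

end

theory Submission
  imports Defs
begin

text \<open>The inverse limit is itself an automaton in which \<open>0\<close> fixes the initial state, and \<open>\<theta>\<close> is
  its own substitution. The substitution of length \<open>p\<close> given by a transition function \<open>\<delta>\<close> acts on
  sequences by \<open>\<theta>(x)(n) = \<delta>(x(n div p), n mod p)\<close>. Hence it is continuous and satisfies
  \<open>\<theta> \<circ> \<sigma>\<^bsup>k\<^esup> = \<sigma>\<^bsup>pk\<^esup> \<circ> \<theta>\<close>, so it preserves the orbit closure of each of its fixed points.
  Termwise maps commute with \<open>\<sigma>\<close>, and the identities of the diagram hold letter by letter.\<close>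

section \<open>Orbit closures and continuous maps between sequence spaces\<close>

lemma shift_funpow: "(shift ^^ k) x = (\<lambda>n. x (n + k))"
  by (induction k) (simp_all add: shift_def)

text \<open>\<open>closure_of\<close> always yields a subset of the ambient space, whether or not
  \<open>y\<close> itself lies there. This is how letters of points of an orbit closure become known
  to be states.\<close>

lemma orbit_closure_in_topspace:
  "x \<in> orbit_closure T y \<Longrightarrow> x n \<in> topspace T"
  unfolding orbit_closure_def
  by (drule subsetD[OF closure_of_subset_topspace]) (simp add: PiE_UNIV_domain Pi_iff)

text \<open>Continuity sends the closure of a set into the closure of its image, so only orbit
  points need checking. The free exponent \<open>l\<close> covers both uses: \<open>l = k\<close>
  for termwise maps and \<open>l = k * p\<close> for substitutions.\<close>

lemma continuous_map_orbit_closure: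
  assumes "continuous_map (product_topology (\<lambda>_. T) UNIV) (product_topology (\<lambda>_. T') UNIV) F"
    and "\<And>k. \<exists>l. F ((shift ^^ k) x) = (shift ^^ l) y"
  shows "F \<in> orbit_closure T x \<rightarrow> orbit_closure T' y"
proof -
  have "F ` orbit_closure T x \<subseteq>
      product_topology (\<lambda>_. T') UNIV closure_of (F ` range (\<lambda>k. (shift ^^ k) x))"
    unfolding orbit_closure_def by (rule continuous_map_image_closure_subset[OF assms(1)])
  also have "\<dots> \<subseteq> orbit_closure T' y"
    unfolding orbit_closure_def using assms(2) by (intro closure_of_mono) blast
  finally show ?thesis by blast
qed

lemma continuous_map_letter: "continuous_map (product_topology (\<lambda>_. T) UNIV) T (\<lambda>x. x n)"
  by (rule continuous_map_product_projection) simp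

lemma termwise_orbit_closure:
  assumes "continuous_map T T' f"
  shows "termwise f \<in> orbit_closure T x \<rightarrow> orbit_closure T' (termwise f x)"
proof (rule continuous_map_orbit_closure)
  show "continuous_map (product_topology (\<lambda>_. T) UNIV) (product_topology (\<lambda>_. T') UNIV) (termwise f)"
    unfolding continuous_map_componentwise_UNIV termwise_def
    using continuous_map_compose[OF continuous_map_letter assms, unfolded o_def] by blast
  show "\<exists>l. termwise f ((shift ^^ k) x) = (shift ^^ l) (termwise f x)" for k
    by (auto simp: termwise_def shift_funpow)
qed

section \<open>Length-\<open>p\<close> substitutions acting on sequences\<close>

lemma subst_seq_substitution:
  assumes "p > 0"
  shows "subst_seq (substitution p A) x n = delta A (x (n div p)) (n mod p)"
proof -
  have "subst_seq (substitution p A) x n = substitution p A (x (n div p)) ! (n mod p)"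
    by (rule subst_seq_uniform[OF assms]) (simp add: substitution_def)
  then show ?thesis
    using assms by (simp add: substitution_def)
qed

text \<open>Each letter of the image depends on a single letter of the argument, so continuity
  reduces to that of the transitions by single digits.\<close>

lemma subst_seq_orbit_closure:
  assumes p: "p > 0"
    and cont: "\<And>i. i < p \<Longrightarrow> continuous_map T T (\<lambda>s. delta A s i)"
    and fix_x: "subst_seq (substitution p A) x = x"
  shows "subst_seq (substitution p A) \<in> orbit_closure T x \<rightarrow> orbit_closure T x"
proof (rule continuous_map_orbit_closure)
  show "continuous_map (product_topology (\<lambda>_. T) UNIV) (product_topology (\<lambda>_. T) UNIV)
      (subst_seq (substitution p A))"
    unfolding continuous_map_componentwise_UNIV subst_seq_substitution[OF p]
  proof
    fix n
    show "continuous_map (product_topology (\<lambda>_. T) UNIV) T (\<lambda>x. delta A (x (n div p)) (n mod p))"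
      using continuous_map_compose[OF continuous_map_letter cont[of "n mod p"]] p
      by (simp add: o_def)
  qed
  \<comment> \<open>Adding \<open>k * p\<close> to an index adds \<open>k\<close> to its quotient by
    \<open>p\<close> and keeps the remainder; \<open>fix_x\<close> then removes the
    substitution.\<close>
  have "subst_seq (substitution p A) ((shift ^^ k) x) = (shift ^^ (k * p)) x" for k
  proof
    fix n
    have "subst_seq (substitution p A) ((shift ^^ k) x) n
        = subst_seq (substitution p A) x (n + k * p)"
      using p by (simp add: subst_seq_substitution shift_funpow add.commute)
    then show "subst_seq (substitution p A) ((shift ^^ k) x) n = (shift ^^ (k * p)) x n"
      by (simp add: fix_x shift_funpow)
  qed
  then show "\<exists>l. subst_seq (substitution p A) ((shift ^^ k) x) = (shift ^^ l) x" for k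
    by blast
qed

section \<open>State sequences generated by an automaton with a loop at its initial state\<close>

lemma generated_state_automaton_0: "generated p (state_automaton A) 0 = initial A"
  by (simp add: generated_def state_automaton_def rep.simps)

text \<open>For \<open>n > 0\<close> the last digit of \<open>rep p n\<close> is
  \<open>n mod p\<close> and the others form \<open>rep p (n div p)\<close>. As
  \<open>rep p 0\<close> is empty, the case \<open>n = 0\<close> instead rests on the loop.\<close>

lemma generated_state_automaton_rec:
  assumes "p \<ge> 2" "delta A (initial A) 0 = initial A"
  shows "generated p (state_automaton A) n
    = delta A (generated p (state_automaton A) (n div p)) (n mod p)"
proof (cases "n = 0")
  case True
  then show ?thesis using assms by (simp add: generated_state_automaton_0)
next
  case False
  then show ?thesis
    using assms(1) by (subst generated_def) (simp add: rep.simps[of p n] generated_def state_automaton_def)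
qed

text \<open>Induction along \<open>n div p\<close>, which is smaller than \<open>n\<close> for
  \<open>n > 0\<close> because \<open>p \<ge> 2\<close>.\<close>

lemma generated_state_automaton_induct:
  assumes "p \<ge> 2" "delta A (initial A) 0 = initial A"
    and "P 0 (initial A)"
    and "\<And>n s. P (n div p) s \<Longrightarrow> P n (delta A s (n mod p))"
  shows "P n (generated p (state_automaton A) n)"
proof (induction n rule: less_induct)
  case (less n)
  show ?case
  proof (cases "n = 0")
    case True
    then show ?thesis using assms(3) by (simp add: generated_state_automaton_0)
  next
    case False
    then show ?thesis
      using assms(1) by (subst generated_state_automaton_rec[OF assms(1,2)]) (intro assms(4) less, simp)
  qed
qed

text \<open>The digit recursion, read over all \<open>n\<close>, is exactly the fixed-point
  equation.\<close>

lemma subst_seq_generated: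
  assumes "p \<ge> 2" "delta A (initial A) 0 = initial A"
  shows "subst_seq (substitution p A) (generated p (state_automaton A))
    = generated p (state_automaton A)"
proof
  fix n
  show "subst_seq (substitution p A) (generated p (state_automaton A)) n
      = generated p (state_automaton A) n"
    using assms(1) by (simp add: subst_seq_substitution generated_state_automaton_rec[OF assms, symmetric])
qed

lemma delta_loop_completion_0:
  "delta (loop_completion c M) (initial (loop_completion c M)) 0 = initial (loop_completion c M)"
  by (simp add: loop_completion_def)

lemma generated_inverse_family:
  assumes fam: "inverse_family p M \<psi>" and p: "p \<ge> 2"
    and loop: "\<And>\<alpha>. delta (M \<alpha>) (initial (M \<alpha>)) 0 = initial (M \<alpha>)"
    and le: "\<alpha> \<le> \<beta>"
  shows "\<psi> \<alpha> \<beta> (generated p (state_automaton (M \<beta>)) n) = generated p (state_automaton (M \<alpha>)) n"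
proof -
  \<comment> \<open>Membership in \<open>states (M \<beta>)\<close> is carried along because
    \<open>\<psi> \<alpha> \<beta>\<close> is known to commute with transitions only on
    states.\<close>
  have "generated p (state_automaton (M \<beta>)) n \<in> states (M \<beta>) \<and>
      \<psi> \<alpha> \<beta> (generated p (state_automaton (M \<beta>)) n) = generated p (state_automaton (M \<alpha>)) n"
    by (rule generated_state_automaton_induct[OF p loop, where P = "\<lambda>n s. s \<in> states (M \<beta>) \<and>
          \<psi> \<alpha> \<beta> s = generated p (state_automaton (M \<alpha>)) n"])
      (use p le in \<open>auto simp: inverse_familyD(2,3,6,7)[OF fam] generated_state_automaton_0
          generated_state_automaton_rec[OF p loop, symmetric]\<close>)
  then show ?thesis ..
qed

section \<open>The inverse limit topology\<close>

lemma topspace_inverse_limit_topology: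
  "topspace (inverse_limit_topology M \<psi>) = states (inverse_limit M \<psi>)"
  by (auto simp: inverse_limit_topology_def inverse_limit_def)

lemma continuous_map_limit_proj:
  "continuous_map (inverse_limit_topology M \<psi>) (discrete_topology (states (M \<alpha>))) (limit_proj \<alpha>)"
  unfolding inverse_limit_topology_def limit_proj_def
  by (intro continuous_map_from_subtopology continuous_map_product_projection) simp

lemma delta_inverse_limit_in_states:
  assumes "inverse_family p M \<psi>" "s \<in> states (inverse_limit M \<psi>)" "i < p"
  shows "delta (inverse_limit M \<psi>) s i \<in> states (inverse_limit M \<psi>)"
  using assms(2,3) by (simp add: inverse_limit_def inverse_familyD(3,7)[OF assms(1)])

text \<open>Continuity into a product is checked by coordinates. Coordinate \<open>\<alpha>\<close>
  factors through \<open>limit_proj \<alpha>\<close> and a map between discrete spaces; closure of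
  the limit under transitions then restricts the codomain.\<close>

lemma continuous_map_delta_inverse_limit:
  assumes fam: "inverse_family p M \<psi>" and i: "i < p"
  shows "continuous_map (inverse_limit_topology M \<psi>) (inverse_limit_topology M \<psi>)
    (\<lambda>s. delta (inverse_limit M \<psi>) s i)"
proof -
  let ?T = "inverse_limit_topology M \<psi>"
  have "continuous_map ?T (discrete_topology (states (M \<alpha>)))
      (\<lambda>s. delta (inverse_limit M \<psi>) s i \<alpha>)" for \<alpha>
  proof -
    have "continuous_map (discrete_topology (states (M \<alpha>))) (discrete_topology (states (M \<alpha>)))
        (\<lambda>s. delta (M \<alpha>) s i)"
      using i by (auto simp: inverse_familyD(3)[OF fam])
    with continuous_map_limit_proj
    have "continuous_map ?T (discrete_topology (states (M \<alpha>))) ((\<lambda>s. delta (M \<alpha>) s i) \<circ> limit_proj \<alpha>)"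
      by (rule continuous_map_compose)
    then show ?thesis
      by (simp add: o_def limit_proj_def inverse_limit_def)
  qed
  then have "continuous_map ?T (product_topology (\<lambda>\<alpha>. discrete_topology (states (M \<alpha>))) UNIV)
      (\<lambda>s. delta (inverse_limit M \<psi>) s i)"
    by (simp add: continuous_map_componentwise_UNIV)
  then have "continuous_map ?T (subtopology (product_topology (\<lambda>\<alpha>. discrete_topology (states (M \<alpha>))) UNIV)
      (states (inverse_limit M \<psi>))) (\<lambda>s. delta (inverse_limit M \<psi>) s i)"
    using delta_inverse_limit_in_states[OF fam _ i]
    by (auto simp: continuous_map_in_subtopology topspace_inverse_limit_topology)
  then show ?thesis
    by (subst (2) inverse_limit_topology_def)
qed

theorem theorem4p2:
  fixes p :: nat
    and M N :: "nat \<Rightarrow> ('s, int) automaton"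
    and \<psi> \<Psi> :: "nat \<Rightarrow> nat \<Rightarrow> 's \<Rightarrow> 's"
    and c :: "nat \<Rightarrow> 's"
    and Minf :: "(nat \<Rightarrow> 's, nat \<Rightarrow> int) automaton"
    and \<theta>fin :: "nat \<Rightarrow> 's \<Rightarrow> 's list"
    and ufin :: "nat \<Rightarrow> nat \<Rightarrow> 's"
    and u :: "nat \<Rightarrow> nat \<Rightarrow> 's"
    and Xfin :: "nat \<Rightarrow> (nat \<Rightarrow> 's) set"
    and X :: "(nat \<Rightarrow> nat \<Rightarrow> 's) set"
  assumes "prime p"
    and "inverse_family p M \<psi>"
    and "\<And>\<alpha>. delta (M \<alpha>) (initial (M \<alpha>)) 0 \<noteq> initial (M \<alpha>) \<Longrightarrow> c \<alpha> \<notin> states (M \<alpha>)"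
  defines "N \<equiv> \<lambda>\<alpha>. loop_completion (c \<alpha>) (M \<alpha>)"
    and "\<Psi> \<equiv> completed_map c M \<psi>"
    and "Minf \<equiv> inverse_limit N \<Psi>"
    and "\<theta>fin \<equiv> \<lambda>\<alpha>. substitution p (N \<alpha>)"
    and "ufin \<equiv> \<lambda>\<alpha>. generated p (state_automaton (N \<alpha>))"
    and "u \<equiv> \<lambda>n \<alpha>. ufin \<alpha> n"
    and "Xfin \<equiv> \<lambda>\<alpha>. orbit_closure (discrete_topology (states (N \<alpha>))) (ufin \<alpha>)"
    and "X \<equiv> orbit_closure (inverse_limit_topology N \<Psi>) u"
  shows "\<exists>\<theta>. uniform_substitution p (states Minf) \<theta> \<and> subst_seq \<theta> u = u \<and>
    (\<forall>\<alpha> \<beta>. \<alpha> \<le> \<beta> \<longrightarrow>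
       subst_seq \<theta> \<in> X \<rightarrow> X \<and>
       subst_seq (\<theta>fin \<beta>) \<in> Xfin \<beta> \<rightarrow> Xfin \<beta> \<and>
       subst_seq (\<theta>fin \<alpha>) \<in> Xfin \<alpha> \<rightarrow> Xfin \<alpha> \<and>
       termwise (limit_proj \<beta>) \<in> X \<rightarrow> Xfin \<beta> \<and>
       termwise (limit_proj \<alpha>) \<in> X \<rightarrow> Xfin \<alpha> \<and>
       termwise (\<Psi> \<alpha> \<beta>) \<in> Xfin \<beta> \<rightarrow> Xfin \<alpha> \<and>
       (\<forall>x\<in>X. termwise (limit_proj \<alpha>) x = termwise (\<Psi> \<alpha> \<beta>) (termwise (limit_proj \<beta>) x)) \<and>
       (\<forall>y\<in>Xfin \<beta>. termwise (\<Psi> \<alpha> \<beta>) (subst_seq (\<theta>fin \<beta>) y) =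
                    subst_seq (\<theta>fin \<alpha>) (termwise (\<Psi> \<alpha> \<beta>) y)) \<and>
       (\<forall>x\<in>X. termwise (limit_proj \<alpha>) (subst_seq \<theta> x) =
                subst_seq (\<theta>fin \<alpha>) (termwise (limit_proj \<alpha>) x)) \<and>
       (\<forall>x\<in>X. termwise (limit_proj \<beta>) (subst_seq \<theta> x) =
                subst_seq (\<theta>fin \<beta>) (termwise (limit_proj \<beta>) x)))"
proof -
  have p: "p \<ge> 2" "p > 0"
    using prime_ge_2_nat[OF assms(1)] by simp_all
  \<comment> \<open>The completed family is again an inverse family, now with a loop at every
    initial state, so no case distinction on extra letters remains.\<close>
  have fam: "inverse_family p N \<Psi>"
    unfolding N_def \<Psi>_def using assms(2) p(2) assms(3) by (rule inverse_family_completion)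
  have loop: "delta (N \<alpha>) (initial (N \<alpha>)) 0 = initial (N \<alpha>)" for \<alpha>
    unfolding N_def by (rule delta_loop_completion_0)
  define \<theta> where "\<theta> = substitution p Minf"
  have seq: "subst_seq \<theta> x n = delta Minf (x (n div p)) (n mod p)" for x n
    unfolding \<theta>_def by (rule subst_seq_substitution[OF p(2)])
  have seq_fin: "subst_seq (\<theta>fin \<alpha>) x n = delta (N \<alpha>) (x (n div p)) (n mod p)" for \<alpha> x n
    unfolding \<theta>fin_def by (rule subst_seq_substitution[OF p(2)])
  have ufin_fix: "subst_seq (\<theta>fin \<alpha>) (ufin \<alpha>) = ufin \<alpha>" for \<alpha>
    unfolding \<theta>fin_def ufin_def by (rule subst_seq_generated[OF p(1) loop])
  \<comment> \<open>Transitions of the limit are defined coordinatewise, so this holds for every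
    sequence \<open>x\<close>. It is thus available for \<open>u\<close> without locating
    \<open>u\<close> in \<open>X\<close>.\<close>
  have proj_comm: "termwise (limit_proj \<alpha>) (subst_seq \<theta> x)
      = subst_seq (\<theta>fin \<alpha>) (termwise (limit_proj \<alpha>) x)" for \<alpha> x
    by (simp add: fun_eq_iff seq seq_fin termwise_def limit_proj_def Minf_def inverse_limit_def)
  have proj_u: "termwise (limit_proj \<alpha>) u = ufin \<alpha>" for \<alpha>
    by (simp add: termwise_def limit_proj_def u_def)
  \<comment> \<open>Equality is tested at each exponent, where it becomes the fixed-point equation
    of \<open>ufin \<alpha>\<close>.\<close>
  have u_fix: "subst_seq \<theta> u = u"
  proof (intro ext)
    fix n \<alpha>
    show "subst_seq \<theta> u n \<alpha> = u n \<alpha>"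
      using fun_cong[OF proj_comm[of \<alpha> u], of n]
      by (simp add: proj_u ufin_fix) (simp add: termwise_def limit_proj_def u_def)
  qed
  \<comment> \<open>The compatibility of coordinates under \<open>\<Psi>\<close> holds for states of
    the limit, so \<open>proj_compat\<close> needs this; \<open>Xfin_states\<close> does the same
    for \<open>psi_comm\<close>.\<close>
  have X_states: "x n \<in> states Minf" if "x \<in> X" for x n
    using orbit_closure_in_topspace[OF that[unfolded X_def]]
    by (simp add: topspace_inverse_limit_topology Minf_def)
  have Xfin_states: "x n \<in> states (N \<alpha>)" if "x \<in> Xfin \<alpha>" for x n \<alpha>
    using orbit_closure_in_topspace[OF that[unfolded Xfin_def]] by simp
  have uniform: "uniform_substitution p (states Minf) \<theta>"
    unfolding uniform_substitution_def \<theta>_def substitution_def Minf_def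
    by (auto simp: delta_inverse_limit_in_states[OF fam])
  have X_inv: "subst_seq \<theta> \<in> X \<rightarrow> X"
    using continuous_map_delta_inverse_limit[OF fam] u_fix p(2)
    unfolding X_def \<theta>_def Minf_def by (intro subst_seq_orbit_closure)
  \<comment> \<open>With discrete topologies, continuity of a transition only says that it maps
    states to states.\<close>
  have Xfin_inv: "subst_seq (\<theta>fin \<alpha>) \<in> Xfin \<alpha> \<rightarrow> Xfin \<alpha>" for \<alpha>
    using ufin_fix[of \<alpha>] p(2) unfolding Xfin_def \<theta>fin_def
    by (intro subst_seq_orbit_closure) (auto simp: inverse_familyD(3)[OF fam])
  have proj_maps: "termwise (limit_proj \<alpha>) \<in> X \<rightarrow> Xfin \<alpha>" for \<alpha>
    using termwise_orbit_closure[OF continuous_map_limit_proj[of N \<Psi> \<alpha>], of u]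
    unfolding X_def Xfin_def proj_u .
  \<comment> \<open>\<open>termwise_orbit_closure\<close> lands in the orbit closure of the image of
    \<open>ufin \<beta>\<close>, so that image has to be identified as
    \<open>ufin \<alpha>\<close>.\<close>
  have psi_maps: "termwise (\<Psi> \<alpha> \<beta>) \<in> Xfin \<beta> \<rightarrow> Xfin \<alpha>" if "\<alpha> \<le> \<beta>" for \<alpha> \<beta>
  proof -
    have "termwise (\<Psi> \<alpha> \<beta>) (ufin \<beta>) = ufin \<alpha>"
      unfolding termwise_def ufin_def using generated_inverse_family[OF fam p(1) loop that] by simp
    moreover have "continuous_map (discrete_topology (states (N \<beta>)))
        (discrete_topology (states (N \<alpha>))) (\<Psi> \<alpha> \<beta>)"
      using inverse_familyD(5)[OF fam that] by auto
    ultimately show ?thesis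
      unfolding Xfin_def using termwise_orbit_closure by metis
  qed
  have proj_compat: "termwise (limit_proj \<alpha>) x = termwise (\<Psi> \<alpha> \<beta>) (termwise (limit_proj \<beta>) x)"
    if "\<alpha> \<le> \<beta>" "x \<in> X" for \<alpha> \<beta> x
    using X_states[OF that(2)] that(1)
    by (simp add: termwise_def limit_proj_def Minf_def inverse_limit_def)
  have psi_comm: "termwise (\<Psi> \<alpha> \<beta>) (subst_seq (\<theta>fin \<beta>) y)
      = subst_seq (\<theta>fin \<alpha>) (termwise (\<Psi> \<alpha> \<beta>) y)" if "\<alpha> \<le> \<beta>" "y \<in> Xfin \<beta>" for \<alpha> \<beta> y
    using Xfin_states[OF that(2)] p(2)
    by (simp add: fun_eq_iff termwise_def seq_fin inverse_familyD(7)[OF fam that(1)])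
  show ?thesis
    by (intro exI[of _ \<theta>] conjI allI impI ballI)
      ((rule uniform u_fix X_inv Xfin_inv proj_maps psi_maps proj_compat psi_comm proj_comm; assumption)+)
qed

end
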